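(* Let $q\ge 2$ and $m\ge 1$ be integers, let $i$ be an integer with $0<i<q^m$, and let $f_i^m(x)=\det(xI-A_m(i))$ be the characteristic polynomial of $A_m(i)$. Then $$f_i^m(x)=g_i^m(x)\,x^{q^m-m-i},\qquad g_i^m(x)=x^m-a_1x^{m-1}-\cdots-a_m,$$ where $a_1a_2\ldots a_m$ is the base $q$ expansion of $q^m-\bar{i}_m$; that is, $a_1,\dots,a_m\in\{0,\dots,q-1\}$ and $q^m-\bar{i}_m=\sum_{k=1}^m a_kq^{m-k}$. (The identity is understood in $\mathbb{Z}[x,x^{-1}]$, since the exponent $q^m-m-i$ may be negative.)
   Context: Fix an integer $q\ge2$. For integers $n,m\ge 0$, $\langle n,m\rangle$ (the part) and $[n,m]$ (the residue) are the unique non-negative integers with $n=q^m\langle n,m\rangle+[n,m]$ and $0\le[n,m]<q^m$. For $m\ge1$, $A_m$ is the $q^m\times q^m$ matrix with entries in $\{0,1\}$ (rows and columns indexed by $1,\dots,q^m$) such that $(A_m)_{ij}=1$ if and only if $[i-1,m-1]=\langle j-1,1\rangle$. For $0\le k< q^m$, $A_m(k)$ is the $(q^m-k)\times(q^m-k)$ matrix obtained from $A_m$ by removing the first $k$ rows and the first $k$ columns. For $0\le n<q^m$ define $l_m(n)=\min\{j : 1\le j\le m,\ \langle n,j\rangle\ge[n,m-j]\}$, and define the minimal prefix of $n$ by $\bar{n}_m=n-[n,m-l_m(n)]=q^{m-l_m(n)}\langle n,m-l_m(n)\rangle$. *)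

theory Defs
  imports
    "Jordan_Normal_Form.Char_Poly"
    "HOL-Computational_Algebra.Formal_Laurent_Series"
    "HOL-Computational_Algebra.Polynomial_FPS"
begin

definition part :: "nat \<Rightarrow> nat \<Rightarrow> nat \<Rightarrow> nat" where
  "part q n m = n div q ^ m"

definition residue :: "nat \<Rightarrow> nat \<Rightarrow> nat \<Rightarrow> nat" where
  "residue q n m = n mod q ^ m"

lemma part_residue_unique:
  assumes "q \<ge> 2"
  shows "n = q ^ m * a + b \<and> b < q ^ m \<longleftrightarrow> a = part q n m \<and> b = residue q n m"
  using assms by (auto simp: part_def residue_def)

text \<open>Matrix indices start at 0 here, so the entry at \<open>(r, s)\<close> is the entry with
  1-based indices \<open>i = r + 1\<close> and \<open>j = s + 1\<close>.\<close>

definition A_mat :: "nat \<Rightarrow> nat \<Rightarrow> int mat" where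
  "A_mat q m = mat (q ^ m) (q ^ m)
     (\<lambda>(r, s). if residue q r (m - 1) = part q s 1 then 1 else 0)"

definition A_mat_trunc :: "nat \<Rightarrow> nat \<Rightarrow> nat \<Rightarrow> int mat" where
  "A_mat_trunc q m k = mat (q ^ m - k) (q ^ m - k)
     (\<lambda>(r, s). A_mat q m $$ (r + k, s + k))"

definition prefix_len :: "nat \<Rightarrow> nat \<Rightarrow> nat \<Rightarrow> nat" where
  "prefix_len q m n = Min {j. 1 \<le> j \<and> j \<le> m \<and> part q n j \<ge> residue q n (m - j)}"

text \<open>For \<open>n < q ^ m\<close> and \<open>m \<ge> 1\<close> the minimum is taken over a finite nonempty set.\<close>

lemma prefix_len_set:
  assumes "m \<ge> 1" "n < q ^ m"
  shows "finite {j. 1 \<le> j \<and> j \<le> m \<and> part q n j \<ge> residue q n (m - j)}"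
    and "m \<in> {j. 1 \<le> j \<and> j \<le> m \<and> part q n j \<ge> residue q n (m - j)}"
  using assms by (auto simp: part_def residue_def)

definition min_prefix :: "nat \<Rightarrow> nat \<Rightarrow> nat \<Rightarrow> nat" where
  "min_prefix q m n = n - residue q n (m - prefix_len q m n)"

lemma min_prefix_eq:
  "min_prefix q m n = q ^ (m - prefix_len q m n) * part q n (m - prefix_len q m n)"
  by (simp add: min_prefix_def part_def residue_def minus_mod_eq_mult_div)

text \<open>The digits are listed from the most significant one, \<open>a 1\<close>, to the least
  significant one, \<open>a m\<close>; values of \<open>a\<close> outside \<open>{1..m}\<close> are irrelevant.\<close>

definition is_base_expansion :: "nat \<Rightarrow> nat \<Rightarrow> nat \<Rightarrow> (nat \<Rightarrow> nat) \<Rightarrow> bool" where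
  "is_base_expansion q m N a \<longleftrightarrow>
     (\<forall>k\<in>{1..m}. a k < q) \<and> N = (\<Sum>k=1..m. a k * q ^ (m - k))"

definition g_poly :: "nat \<Rightarrow> (nat \<Rightarrow> nat) \<Rightarrow> int poly" where
  "g_poly m a = monom 1 m - (\<Sum>k=1..m. monom (int (a k)) (m - k))"

text \<open>The inclusion of the integer polynomials into the formal Laurent series, whose subring
  generated by \<open>X\<close> and its inverse is the ring of Laurent polynomials.\<close>

definition fls_of_int_poly :: "int poly \<Rightarrow> int fls" where
  "fls_of_int_poly p = fps_to_fls (fps_of_poly p)"

end

theory Submission
  imports Defs
begin

text \<open>
  Read the numbers below \<open>q ^ m\<close> as words of \<open>m\<close> digits in base \<open>q\<close>, most significant digit
  first. Then \<open>A_mat q m\<close> is the adjacency matrix of the de Bruijn graph, and \<open>A_mat_trunc q m i\<close>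
  that of its restriction to the words \<open>s \<ge> i\<close>. The proof rests on how this matrix acts from the
  right on the threshold functions \<open>\<chi>\<^sub>t s = [t \<le> s]\<close> with \<open>i \<le> t < q ^ m\<close>.

  A word \<open>s\<close> has \<open>q\<close> predecessors: delete its last digit and prepend a digit \<open>c\<close>. Such a
  predecessor is at least \<open>t\<close> if and only if \<open>c\<close> exceeds the leading digit \<open>d\<close> of \<open>t\<close>, or
  \<open>c = d\<close> and \<open>s\<close> is at least the word \<open>\<sigma> t\<close> obtained from \<open>t\<close> by deleting its leading digit
  and appending a zero. Since all words considered are at least \<open>i\<close>, this gives
  \<open>\<chi>\<^sub>t A = (q - 1 - d) \<chi>\<^sub>i + \<chi>\<^sub>u\<close> with \<open>u = max i (\<sigma> t)\<close>.
  The threshold functions form a unitriangular basis, so \<open>A\<close> has the same characteristic polynomial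
  as the matrix \<open>F + b e\<close>, where \<open>F\<close> is the partial map \<open>t \<mapsto> \<sigma> t\<close> (defined while
  \<open>\<sigma> t > i\<close>), \<open>e\<close> is the unit row vector at the state \<open>i\<close>, and
  \<open>b t = q - 1 - d + [\<sigma> t \<le> i]\<close>. This is \<open>threshold_mat_intertwines\<close>.

  After \<open>m\<close> shifts every word is zero, so \<open>F ^ m = 0\<close>. For a column perturbation of a nilpotent
  matrix the characteristic polynomial is explicit: \<open>char_poly_nilpotent_column_update\<close> gives
  \<open>x ^ n (1 - (\<Sum>k<m. (F ^ k b) i / x ^ (k + 1)))\<close> with \<open>n = q ^ m - i\<close>.

  Finally \<open>(F ^ k b) i\<close> equals \<open>b (\<sigma> ^ k i)\<close> as long as the orbit of \<open>i\<close> under \<open>\<sigma>\<close> has stayed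
  above \<open>i\<close>, and is zero afterwards. The first \<open>l \<ge> 1\<close> with \<open>\<sigma> ^ l i \<le> i\<close> is exactly the length
  of the minimal prefix of \<open>i\<close>. The coefficients are therefore the complemented digits
  \<open>q - 1 - i\<^sub>k\<close> for \<open>k < l\<close>, then \<open>q - i\<^sub>l\<close>, then zeros; these are the digits of
  \<open>q ^ m\<close> minus the minimal prefix (\<open>orbit_digits_base_expansion\<close>).
\<close>

section \<open>Characteristic polynomials of perturbed nilpotent matrices\<close>

lemma monic_factor_of_monom:
  fixes p q :: "'a :: idom poly"
  assumes "p * q = monom 1 k" and "monic p"
  shows "p = monom 1 (degree p)"
  using assms
proof (induction k arbitrary: p q)
  case 0
  then have "p dvd 1" by (metis dvd_triv_left monom_eq_1)
  then have "degree p = 0" by (simp add: poly_dvd_1)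
  then show ?case
    using 0 by (metis degree_0_id monom_0)
next
  case (Suc k)
  have "coeff p 0 * coeff q 0 = 0"
    using arg_cong[OF Suc.prems(1), of "\<lambda>r. coeff r 0"] by (simp add: coeff_mult)
  then consider "coeff p 0 = 0" | "coeff q 0 = 0" by auto
  then show ?case
  proof cases
    case 1
    obtain p' where p: "p = pCons 0 p'"
      using 1 by (metis coeff_pCons_0 pCons_cases)
    have "p' * q = monom 1 k" and "monic p'" and "p' \<noteq> 0"
      using Suc.prems p by (auto simp: monom_Suc split: if_splits)
    then show ?thesis
      using Suc.IH[of p' q] p by (simp add: monom_Suc)
  next
    case 2
    obtain q' where q: "q = pCons 0 q'"
      using 2 by (metis coeff_pCons_0 pCons_cases)
    have "p * q' = monom 1 k"
      using Suc.prems q by (auto simp: monom_Suc)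
    then show ?thesis using Suc.IH Suc.prems(2) by blast
  qed
qed

lemma char_poly_matrix_dim [simp]:
  "dim_row (char_poly_matrix A) = dim_row A" "dim_col (char_poly_matrix A) = dim_col A"
  by (simp_all add: char_poly_matrix_def)

lemma char_poly_matrix_index:
  assumes "A \<in> carrier_mat n n" "r < n" "c < n"
  shows "char_poly_matrix A $$ (r, c) = (if r = c then monom 1 1 else 0) - [:A $$ (r, c):]"
  using assms by (auto simp: char_poly_matrix_def x_as_monom)

text \<open>The geometric series of \<open>1 / (x - A)\<close>, multiplied by \<open>x ^ m\<close> and cut off before \<open>A ^ m\<close>.
  For \<open>A ^ m = 0\<close> nothing is lost, which makes \<open>x - A\<close> invertible up to a power of \<open>x\<close> within
  polynomial matrices.\<close>

definition truncated_resolvent :: "nat \<Rightarrow> 'a :: comm_ring_1 mat \<Rightarrow> 'a poly mat" where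
  "truncated_resolvent m A = mat (dim_row A) (dim_row A)
     (\<lambda>(r, c). \<Sum>k<m. monom ((A ^\<^sub>m k) $$ (r, c)) (m - 1 - k))"

lemma mat_mult_index:
  assumes "A \<in> carrier_mat n n" "B \<in> carrier_mat n n" "r < n" "c < n"
  shows "(A * B) $$ (r, c) = (\<Sum>j<n. A $$ (r, j) * B $$ (j, c))"
  using assms by (auto simp: scalar_prod_def atLeast0LessThan)

lemma sum_monom: "(\<Sum>j\<in>S. monom (f j) k) = monom (\<Sum>j\<in>S. f j) k"
  by (induction S rule: infinite_finite_induct) (auto simp: add_monom)

lemma truncated_resolvent_mult:
  fixes A :: "'a :: comm_ring_1 mat"
  assumes A: "A \<in> carrier_mat n n" and nil: "A ^\<^sub>m m = 0\<^sub>m n n"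
  shows "truncated_resolvent m A * char_poly_matrix A = monom 1 m \<cdot>\<^sub>m 1\<^sub>m n"
proof (rule eq_matI)
  fix r c assume "r < dim_row (monom (1::'a) m \<cdot>\<^sub>m 1\<^sub>m n)" and "c < dim_col (monom (1::'a) m \<cdot>\<^sub>m 1\<^sub>m n)"
  then have rc: "r < n" "c < n" by auto
  let ?Q = "truncated_resolvent m A"
  let ?p = "\<lambda>k. (A ^\<^sub>m k) $$ (r, c)"
  have Q: "?Q \<in> carrier_mat n n" using A by (auto simp: truncated_resolvent_def)
  have "(?Q * char_poly_matrix A) $$ (r, c) = (\<Sum>j<n. ?Q $$ (r, j) * char_poly_matrix A $$ (j, c))"
    using Q A rc by (intro mat_mult_index) auto
  also have "\<dots> = (\<Sum>j<n. (if j = c then ?Q $$ (r, j) * monom 1 1 else 0) - ?Q $$ (r, j) * [:A $$ (j, c):])"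
    by (intro sum.cong refl) (use A rc in \<open>auto simp: char_poly_matrix_index algebra_simps\<close>)
  also have "\<dots> = ?Q $$ (r, c) * monom 1 1 - (\<Sum>j<n. ?Q $$ (r, j) * [:A $$ (j, c):])"
    using rc by (simp add: sum_subtractf)
  also have "?Q $$ (r, c) * monom 1 1 = (\<Sum>k<m. monom (?p k) (m - k))"
    using A rc by (auto simp: truncated_resolvent_def sum_distrib_right mult_monom Suc_diff_Suc intro!: sum.cong)
  also have "(\<Sum>j<n. ?Q $$ (r, j) * [:A $$ (j, c):])
      = (\<Sum>j<n. \<Sum>k<m. monom ((A ^\<^sub>m k) $$ (r, j) * A $$ (j, c)) (m - Suc k))"
    using A rc by (auto simp: truncated_resolvent_def sum_distrib_right mult_monom monom_0[symmetric] intro!: sum.cong)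
  also have "\<dots> = (\<Sum>k<m. \<Sum>j<n. monom ((A ^\<^sub>m k) $$ (r, j) * A $$ (j, c)) (m - Suc k))"
    by (rule sum.swap)
  also have "\<dots> = (\<Sum>k<m. monom (?p (Suc k)) (m - Suc k))"
    by (intro sum.cong refl)
      (use A rc mat_mult_index[of "A ^\<^sub>m k" n A r c for k] in \<open>auto simp: sum_monom\<close>)
  also have "(\<Sum>k<m. monom (?p k) (m - k)) - (\<Sum>k<m. monom (?p (Suc k)) (m - Suc k))
      = monom (?p 0) m - monom (?p m) 0"
    using sum_lessThan_telescope'[of "\<lambda>k. monom (?p k) (m - k)" m] by (simp add: sum_subtractf)
  also have "\<dots> = (monom 1 m \<cdot>\<^sub>m 1\<^sub>m n) $$ (r, c)"
    using A rc nil by auto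
  finally show "(?Q * char_poly_matrix A) $$ (r, c) = (monom 1 m \<cdot>\<^sub>m 1\<^sub>m n) $$ (r, c)" .
qed (use A in \<open>auto simp: truncated_resolvent_def\<close>)

text \<open>By the truncated resolvent, the characteristic polynomial divides a power of \<open>x\<close>; being
  monic of degree \<open>n\<close>, it is \<open>x ^ n\<close>.\<close>

lemma char_poly_nilpotent:
  fixes A :: "'a :: idom mat"
  assumes A: "A \<in> carrier_mat n n" and nil: "A ^\<^sub>m m = 0\<^sub>m n n"
  shows "char_poly A = monom 1 n"
proof -
  have Q: "truncated_resolvent m A \<in> carrier_mat n n"
    using A by (auto simp: truncated_resolvent_def)
  have "det (truncated_resolvent m A) * char_poly A = monom 1 m ^ n"
    using truncated_resolvent_mult[OF A nil] det_mult[OF Q char_poly_matrix_closed[OF A]]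
    by (simp add: char_poly_def)
  then have "char_poly A * det (truncated_resolvent m A) = monom 1 (m * n)"
    by (simp add: monom_power mult.commute)
  then show ?thesis
    using monic_factor_of_monom degree_monic_char_poly[OF A] by metis
qed

text \<open>Multiplying \<open>x - B\<close> by the truncated resolvent \<open>Q\<close> of \<open>A\<close> leaves a matrix that differs from
  \<open>x ^ m\<close> times the identity only in column 0, where \<open>Q b\<close> is subtracted. Its determinant is the
  product of its diagonal, and \<open>det Q\<close> is known from the unperturbed case, so the characteristic
  polynomial of \<open>B\<close> can be solved for.\<close>

lemma char_poly_nilpotent_column_update:
  fixes A :: "'a :: idom mat" and b :: "nat \<Rightarrow> 'a"
  assumes A: "A \<in> carrier_mat n n" and nil: "A ^\<^sub>m m = 0\<^sub>m n n" and n: "0 < n"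
    and B: "B = mat n n (\<lambda>(r, c). A $$ (r, c) + (if c = 0 then b r else 0))"
  shows "monom 1 m * char_poly B
    = monom 1 n * (monom 1 m - (\<Sum>k<m. monom (\<Sum>j<n. (A ^\<^sub>m k) $$ (0, j) * b j) (m - 1 - k)))"
proof -
  define Q where "Q = truncated_resolvent m A"
  define y where "y r = (\<Sum>j<n. Q $$ (r, j) * [:b j:])" for r
  define G where "G = mat n n (\<lambda>(r, c). (if r = c then monom 1 m else 0) - (if c = 0 then y r else 0))"
  have Q: "Q \<in> carrier_mat n n" using A by (auto simp: Q_def truncated_resolvent_def)
  have Bc: "B \<in> carrier_mat n n" by (simp add: B)
  have "Q * char_poly_matrix B = G"
  proof (rule eq_matI)
    fix r c assume "r < dim_row G" "c < dim_col G"
    then have rc: "r < n" "c < n" by (auto simp: G_def)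
    have "(Q * char_poly_matrix B) $$ (r, c) = (\<Sum>j<n. Q $$ (r, j) * char_poly_matrix B $$ (j, c))"
      using Q Bc rc by (intro mat_mult_index) auto
    also have "\<dots> = (\<Sum>j<n. Q $$ (r, j) * char_poly_matrix A $$ (j, c)
        - (if c = 0 then Q $$ (r, j) * [:b j:] else 0))"
    proof (intro sum.cong refl)
      fix j assume "j \<in> {..<n}"
      then have "char_poly_matrix B $$ (j, c) = char_poly_matrix A $$ (j, c) - (if c = 0 then [:b j:] else 0)"
        using char_poly_matrix_index[OF A, of j c] char_poly_matrix_index[OF Bc, of j c] rc
        by (auto simp: B)
      then show "Q $$ (r, j) * char_poly_matrix B $$ (j, c) = Q $$ (r, j) * char_poly_matrix A $$ (j, c)
          - (if c = 0 then Q $$ (r, j) * [:b j:] else 0)"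
        by (simp only: right_diff_distrib) simp
    qed
    also have "\<dots> = (Q * char_poly_matrix A) $$ (r, c) - (if c = 0 then y r else 0)"
      using mat_mult_index[OF Q char_poly_matrix_closed[OF A] rc]
      by (simp add: sum_subtractf y_def)
    also have "\<dots> = G $$ (r, c)"
      unfolding Q_def truncated_resolvent_mult[OF A nil] using rc by (auto simp: G_def)
    finally show "(Q * char_poly_matrix B) $$ (r, c) = G $$ (r, c)" .
  qed (use Q Bc in \<open>auto simp: G_def\<close>)
  then have QB: "det Q * char_poly B = det G"
    using det_mult[OF Q char_poly_matrix_closed[OF Bc]] by (simp add: char_poly_def)
  have "det Q * char_poly A = monom 1 m ^ n"
    using truncated_resolvent_mult[OF A nil] det_mult[OF Q char_poly_matrix_closed[OF A]]
    by (simp add: char_poly_def Q_def)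
  then have QA: "det Q * monom 1 n = monom 1 m ^ n"
    using char_poly_nilpotent[OF A nil] by simp
  have "det G = prod_list (diag_mat G)"
    by (rule det_lower_triangular[of n]) (auto simp: G_def)
  also have "\<dots> = (\<Prod>r<n. G $$ (r, r))"
    by (simp add: prod_list_diag_prod G_def atLeast0LessThan)
  also have "\<dots> = (monom 1 m - y 0) * monom 1 m ^ (n - 1)"
  proof -
    have "{..<n} = insert 0 {1..<n}" using n by auto
    then show ?thesis using n by (simp add: G_def)
  qed
  finally have G: "det G = (monom 1 m - y 0) * monom 1 m ^ (n - 1)" .
  have "monom 1 m ^ (n - 1) * (monom 1 m * char_poly B) = monom 1 m ^ n * char_poly B"
    using n by (cases n) auto
  also have "\<dots> = monom 1 n * (det Q * char_poly B)"
    unfolding QA[symmetric] by (simp only: ac_simps)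
  also have "\<dots> = monom 1 m ^ (n - 1) * (monom 1 n * (monom 1 m - y 0))"
    unfolding QB G by (simp only: ac_simps)
  finally have "monom 1 m * char_poly B = monom 1 n * (monom 1 m - y 0)"
    by (simp add: monom_eq_0_iff)
  moreover have "y 0 = (\<Sum>k<m. monom (\<Sum>j<n. (A ^\<^sub>m k) $$ (0, j) * b j) (m - 1 - k))"
  proof -
    have "y 0 = (\<Sum>j<n. \<Sum>k<m. monom ((A ^\<^sub>m k) $$ (0, j) * b j) (m - 1 - k))"
      unfolding y_def using A n
      by (auto simp: Q_def truncated_resolvent_def sum_distrib_right mult_monom monom_0[symmetric] intro!: sum.cong)
    also have "\<dots> = (\<Sum>k<m. monom (\<Sum>j<n. (A ^\<^sub>m k) $$ (0, j) * b j) (m - 1 - k))"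
      by (subst sum.swap) (simp add: sum_monom)
    finally show ?thesis .
  qed
  ultimately show ?thesis by simp
qed

text \<open>Similarity expressed without an inverse of \<open>P\<close>: over an integral domain \<open>det P\<close> cancels.\<close>

lemma char_poly_intertwine:
  fixes A B P :: "'a :: idom mat"
  assumes A: "A \<in> carrier_mat n n" and B: "B \<in> carrier_mat n n" and P: "P \<in> carrier_mat n n"
    and PA: "P * A = B * P" and det: "det P \<noteq> 0"
  shows "char_poly A = char_poly B"
proof -
  interpret lift: comm_ring_hom "\<lambda>a :: 'a. [:a:]"
    by unfold_locales (auto simp: one_pCons)
  let ?P = "map_mat (\<lambda>a. [:a:]) P"
  have P': "?P \<in> carrier_mat n n" using P by simp
  have "?P * char_poly_matrix A = char_poly_matrix B * ?P"
  proof (rule eq_matI)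
    fix r c assume "r < dim_row (char_poly_matrix B * ?P)" "c < dim_col (char_poly_matrix B * ?P)"
    then have rc: "r < n" "c < n" using B P by auto
    have s: "(\<Sum>j<n. [:f j:]) = [:\<Sum>j<n. f j:]" for f :: "nat \<Rightarrow> 'a"
      using lift.hom_sum[of f "{..<n}"] by simp
    have "(?P * char_poly_matrix A) $$ (r, c)
        = (\<Sum>j<n. (if j = c then [:P $$ (r, j):] * monom 1 1 else 0) - [:P $$ (r, j) * A $$ (j, c):])"
      unfolding mat_mult_index[OF P' char_poly_matrix_closed[OF A] rc]
      by (intro sum.cong refl) (use A P rc in \<open>auto simp: char_poly_matrix_index right_diff_distrib\<close>)
    also have "\<dots> = [:P $$ (r, c):] * monom 1 1 - [:(P * A) $$ (r, c):]"
      using mat_mult_index[OF P A rc] rc by (simp add: sum_subtractf s)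
    also have "\<dots> = monom 1 1 * [:P $$ (r, c):] - [:(B * P) $$ (r, c):]"
      by (simp add: PA mult.commute)
    also have "\<dots> = (\<Sum>j<n. (if j = r then monom 1 1 * [:P $$ (j, c):] else 0) - [:B $$ (r, j) * P $$ (j, c):])"
      using mat_mult_index[OF B P rc] rc by (simp add: sum_subtractf s)
    also have "\<dots> = (char_poly_matrix B * ?P) $$ (r, c)"
      unfolding mat_mult_index[OF char_poly_matrix_closed[OF B] P' rc]
      by (intro sum.cong refl) (use B P rc in \<open>auto simp: char_poly_matrix_index left_diff_distrib smult_diff_right mult.commute\<close>)
    finally show "(?P * char_poly_matrix A) $$ (r, c) = (char_poly_matrix B * ?P) $$ (r, c)" .
  qed (use A B P in auto)
  then have "det ?P * char_poly A = char_poly B * det ?P"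
    using det_mult[OF P' char_poly_matrix_closed[OF A]] det_mult[OF char_poly_matrix_closed[OF B] P']
    by (simp add: char_poly_def)
  moreover have "det ?P \<noteq> 0" using det by (simp add: lift.hom_det)
  ultimately show ?thesis by (metis mult.commute mult_right_cancel)
qed

section \<open>Deleting the leading digit\<close>

text \<open>On words of \<open>m\<close> digits: drop the leading digit and append a zero.\<close>

definition digit_shift :: "nat \<Rightarrow> nat \<Rightarrow> nat \<Rightarrow> nat" where
  "digit_shift q m t = q * (t mod q ^ (m - 1))"

lemma digit_shift_less:
  assumes "0 < q" "0 < m"
  shows "digit_shift q m t < q ^ m"
proof -
  have "q * (t mod q ^ (m - 1)) < q * q ^ (m - 1)" using assms by simp
  also have "\<dots> = q ^ m" using assms by (cases m) auto
  finally show ?thesis by (simp add: digit_shift_def)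
qed

lemma digit_shift_funpow:
  assumes "k \<le> m" "t < q ^ m"
  shows "(digit_shift q m ^^ k) t = q ^ k * (t mod q ^ (m - k))"
  using assms(1)
proof (induction k)
  case 0
  then show ?case using assms by simp
next
  case (Suc k)
  have "(digit_shift q m ^^ Suc k) t = digit_shift q m (q ^ k * (t mod q ^ (m - k)))"
    using Suc by simp
  also have "\<dots> = q * ((q ^ k * (t mod q ^ (m - k))) mod q ^ (m - 1))"
    by (simp only: digit_shift_def)
  also have "q ^ (m - 1) = q ^ k * q ^ (m - Suc k)"
    using Suc.prems by (simp flip: power_add)
  also have "q * ((q ^ k * (t mod q ^ (m - k))) mod \<dots>) = q ^ Suc k * (t mod q ^ (m - k) mod q ^ (m - Suc k))"
    by (simp add: mult_mod_right[symmetric])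
  also have "t mod q ^ (m - k) mod q ^ (m - Suc k) = t mod q ^ (m - Suc k)"
    by (rule mod_mod_cancel) (simp add: le_imp_power_dvd)
  finally show ?case .
qed

text \<open>The inequality that defines the minimal prefix is a comparison of a word with its shifts, so the
  prefix length is the time of first return of the orbit to the words at most \<open>t\<close>.\<close>

lemma digit_shift_funpow_le_iff:
  assumes "k \<le> m" "t < q ^ m" "0 < q"
  shows "(digit_shift q m ^^ k) t \<le> t \<longleftrightarrow> residue q t (m - k) \<le> part q t k"
  using assms by (simp add: digit_shift_funpow residue_def part_def less_eq_div_iff_mult_less_eq mult.commute)

section \<open>The action on threshold functions\<close>

text \<open>In the matrices below, index \<open>t\<close> stands for the word \<open>t + i\<close>. In particular, column 0 belongs
  to the constant threshold function \<open>\<chi>\<^sub>i\<close>.\<close>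

definition threshold_mat :: "nat \<Rightarrow> int mat" where
  "threshold_mat n = mat n n (\<lambda>(t, s). if t \<le> s then 1 else 0)"

definition shift_mat :: "nat \<Rightarrow> nat \<Rightarrow> nat \<Rightarrow> int mat" where
  "shift_mat q m i = mat (q ^ m - i) (q ^ m - i)
     (\<lambda>(t, s). if i < digit_shift q m (t + i) \<and> s + i = digit_shift q m (t + i) then 1 else 0)"

text \<open>The coefficient of \<open>\<chi>\<^sub>i\<close> in the image of \<open>\<chi>\<^sub>t\<close>: one for each digit above the leading digit
  of \<open>t\<close>, and one more if the shifted threshold is at most \<open>i\<close> and hence coincides with \<open>\<chi>\<^sub>i\<close> on
  the words considered.\<close>

definition weight :: "nat \<Rightarrow> nat \<Rightarrow> nat \<Rightarrow> nat \<Rightarrow> nat" where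
  "weight q m i t = q - 1 - t div q ^ (m - 1) + (if digit_shift q m t \<le> i then 1 else 0)"

definition threshold_action :: "nat \<Rightarrow> nat \<Rightarrow> nat \<Rightarrow> int mat" where
  "threshold_action q m i = mat (q ^ m - i) (q ^ m - i)
     (\<lambda>(t, s). shift_mat q m i $$ (t, s) + (if s = 0 then int (weight q m i (t + i)) else 0))"

text \<open>Counts the admissible predecessors of a word: with \<open>M = q ^ (m - 1)\<close>, they are the words
  \<open>c M + e\<close> for a leading digit \<open>c\<close>.\<close>

lemma card_residue_class_above:
  fixes M q e T :: nat
  assumes e: "e < M" and T: "T < q * M"
  shows "card {w. T \<le> w \<and> w < q * M \<and> w mod M = e}
    = q - 1 - T div M + (if T mod M \<le> e then 1 else 0)"
proof -
  have M: "0 < M" using e by simp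
  have d: "T div M < q" using T M by (simp add: div_less_iff_less_mult)
  have above: "T \<le> c * M + e \<longleftrightarrow> T div M < c \<or> T div M = c \<and> T mod M \<le> e" for c
  proof (cases "T div M" c rule: linorder_cases)
    case less
    then have "T < c * M" using M by (simp add: div_less_iff_less_mult)
    with less show ?thesis by simp
  next
    case equal
    then have "T = c * M + T mod M" by (metis div_mult_mod_eq)
    with equal show ?thesis by (metis add_le_cancel_left less_irrefl)
  next
    case greater
    then have "Suc c * M \<le> T"
      using M by (metis Suc_leI less_eq_div_iff_mult_less_eq)
    with greater e show ?thesis by auto
  qed
  have "{w. T \<le> w \<and> w < q * M \<and> w mod M = e} = (\<lambda>c. c * M + e) ` {c. c < q \<and> T \<le> c * M + e}"
  proof (intro equalityI subsetI)
    fix w assume w: "w \<in> {w. T \<le> w \<and> w < q * M \<and> w mod M = e}"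
    then have "w = w div M * M + e" by auto
    moreover have "w div M < q" using w M by (simp add: div_less_iff_less_mult)
    ultimately show "w \<in> (\<lambda>c. c * M + e) ` {c. c < q \<and> T \<le> c * M + e}" using w by auto
  next
    fix w assume "w \<in> (\<lambda>c. c * M + e) ` {c. c < q \<and> T \<le> c * M + e}"
    then obtain c where c: "c < q" "T \<le> c * M + e" "w = c * M + e" by auto
    have "c * M + e < Suc c * M" using e by simp
    also have "\<dots> \<le> q * M" using c by (intro mult_le_mono1) auto
    finally show "w \<in> {w. T \<le> w \<and> w < q * M \<and> w mod M = e}" using c e by auto
  qed
  also have "card \<dots> = card {c. c < q \<and> T \<le> c * M + e}"
    using M by (intro card_image inj_onI) auto
  also have "{c. c < q \<and> T \<le> c * M + e}
      = {T div M <..<q} \<union> (if T mod M \<le> e then {T div M} else {})"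
    using d by (auto simp: above)
  also have "card \<dots> = q - 1 - T div M + (if T mod M \<le> e then 1 else 0)"
    by auto
  finally show ?thesis .
qed

text \<open>Entry \<open>(t, s)\<close> of the left-hand side counts the predecessors of \<open>s\<close> that are at least \<open>t\<close>.
  If the leading digit of such a predecessor equals that of \<open>t\<close>, then comparing the remaining
  digits amounts to comparing \<open>s\<close> with the shift of \<open>t\<close>, because
  \<open>x \<le> s div q\<close> means \<open>q x \<le> s\<close>.\<close>

lemma threshold_mat_intertwines:
  assumes q: "0 < q" and m: "0 < m" and i: "i < q ^ m"
  defines "P \<equiv> threshold_mat (q ^ m - i)"
  shows "P * A_mat_trunc q m i = threshold_action q m i * P"
proof -
  define N M where "N = q ^ m - i" and "M = q ^ (m - 1)"
  have qM: "q * M = q ^ m" using m by (cases m) (auto simp: M_def)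
  have P: "P \<in> carrier_mat N N" by (simp add: P_def threshold_mat_def N_def)
  have A: "A_mat_trunc q m i \<in> carrier_mat N N" by (simp add: A_mat_trunc_def N_def)
  have B: "threshold_action q m i \<in> carrier_mat N N" by (simp add: threshold_action_def N_def)
  show ?thesis
  proof (rule eq_matI)
    fix t s assume "t < dim_row (threshold_action q m i * P)" "s < dim_col (threshold_action q m i * P)"
    then have ts: "t < N" "s < N" using B P by auto
    define T S where "T = t + i" and "S = s + i"
    have TS: "T < q * M" "S < q * M" using ts by (auto simp: T_def S_def N_def qM)
    have e: "S div q < M" using TS q by (simp add: div_less_iff_less_mult mult.commute)
    have "(P * A_mat_trunc q m i) $$ (t, s)
        = (\<Sum>w<N. if t \<le> w \<and> (w + i) mod M = S div q then 1 else 0)"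
      unfolding mat_mult_index[OF P A ts]
      by (intro sum.cong refl)
        (use ts in \<open>auto simp: P_def threshold_mat_def A_mat_trunc_def A_mat_def residue_def part_def
          N_def M_def S_def\<close>)
    also have "\<dots> = int (card {w. w < N \<and> t \<le> w \<and> (w + i) mod M = S div q})"
      by (simp add: sum.If_cases lessThan_def Collect_conj_eq Int_assoc)
    also have "card {w. w < N \<and> t \<le> w \<and> (w + i) mod M = S div q}
        = card {w. T \<le> w \<and> w < q * M \<and> w mod M = S div q}"
    proof (rule bij_betw_same_card)
      show "bij_betw (\<lambda>w. w + i) {w. w < N \<and> t \<le> w \<and> (w + i) mod M = S div q}
          {w. T \<le> w \<and> w < q * M \<and> w mod M = S div q}"
        by (rule bij_betw_byWitness[where f' = "\<lambda>w. w - i"])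
          (use i in \<open>auto simp: T_def N_def qM\<close>)
    qed
    also have "\<dots> = q - 1 - T div M + (if T mod M \<le> S div q then 1 else 0)"
      by (rule card_residue_class_above[OF e TS(1)])
    also have "T mod M \<le> S div q \<longleftrightarrow> digit_shift q m T \<le> S"
      using q by (simp add: digit_shift_def M_def less_eq_div_iff_mult_less_eq mult.commute)
    also have "int (q - 1 - T div M + (if digit_shift q m T \<le> S then 1 else 0))
        = (if i < digit_shift q m T \<and> digit_shift q m T \<le> S then 1 else 0) + int (weight q m i T)"
      by (auto simp: weight_def M_def S_def)
    \<comment> \<open>Each of the two terms is spread over the single column in which \<open>threshold_action\<close> has it.\<close>
    also have "\<dots> = (\<Sum>j<N. (if j = digit_shift q m T - i
        then (if i < digit_shift q m T \<and> digit_shift q m T \<le> S then 1 else 0) else 0)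
        + (if j = 0 then int (weight q m i T) else 0))"
      using digit_shift_less[OF q m, of T] ts by (auto simp: sum.distrib N_def)
    also have "\<dots> = (threshold_action q m i * P) $$ (t, s)"
      unfolding mat_mult_index[OF B P ts]
      by (intro sum.cong refl)
        (use ts in \<open>auto simp: P_def threshold_mat_def threshold_action_def shift_mat_def
          T_def S_def N_def\<close>)
    finally show "(P * A_mat_trunc q m i) $$ (t, s) = (threshold_action q m i * P) $$ (t, s)" .
  qed (use A B P in auto)
qed

lemma char_poly_A_mat_trunc_threshold:
  assumes "0 < q" "0 < m" "i < q ^ m"
  shows "char_poly (A_mat_trunc q m i) = char_poly (threshold_action q m i)"
proof (rule char_poly_intertwine[where n = "q ^ m - i"])
  show "threshold_mat (q ^ m - i) * A_mat_trunc q m i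
      = threshold_action q m i * threshold_mat (q ^ m - i)"
    by (rule threshold_mat_intertwines[OF assms])
  have "det (threshold_mat n) = 1" for n
  proof -
    have "det (threshold_mat n) = prod_list (diag_mat (threshold_mat n))"
      by (rule det_upper_triangular[of _ n]) (auto simp: threshold_mat_def)
    then show ?thesis by (simp add: prod_list_diag_prod threshold_mat_def)
  qed
  then show "det (threshold_mat (q ^ m - i)) \<noteq> 0" by simp
qed (simp_all add: A_mat_trunc_def threshold_action_def threshold_mat_def)

section \<open>The orbit of the truncation point\<close>

lemma shift_mat_power:
  assumes q: "0 < q" and m: "0 < m" and r: "r < q ^ m - i" and c: "c < q ^ m - i"
  shows "(shift_mat q m i ^\<^sub>m k) $$ (r, c)
    = (if (\<forall>j\<in>{1..k}. i < (digit_shift q m ^^ j) (r + i)) \<and> c + i = (digit_shift q m ^^ k) (r + i)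
       then 1 else 0)"
  using c
proof (induction k arbitrary: c)
  case 0
  then show ?case using r by (simp add: shift_mat_def)
next
  case (Suc k)
  define N where "N = q ^ m - i"
  let ?F = "shift_mat q m i"
  let ?s = "\<lambda>j. (digit_shift q m ^^ j) (r + i)"
  have F: "?F \<in> carrier_mat N N" by (simp add: shift_mat_def N_def)
  have "?s k < q ^ m" using digit_shift_less[OF q m] r by (cases k) auto
  have "(?F ^\<^sub>m Suc k) $$ (r, c) = (\<Sum>j<N. (?F ^\<^sub>m k) $$ (r, j) * ?F $$ (j, c))"
    using mat_mult_index[of "?F ^\<^sub>m k" N ?F r c] F r Suc.prems by (simp add: N_def)
  also have "\<dots> = (\<Sum>j<N. if j + i = ?s k
      then (if \<forall>j\<in>{1..Suc k}. i < ?s j then if c + i = ?s (Suc k) then 1 else 0 else 0) else 0)"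
    by (intro sum.cong refl)
      (use Suc in \<open>auto simp: shift_mat_def N_def atLeastAtMostSuc_conv\<close>)
  also have "\<dots> = (\<Sum>j<N. if j = ?s k - i
      then (if \<forall>j\<in>{1..Suc k}. i < ?s j then if c + i = ?s (Suc k) then 1 else 0 else 0) else 0)"
  proof (cases "\<forall>j\<in>{1..Suc k}. i < ?s j")
    case True
    then have "i < ?s k" if "0 < k" using that by simp
    then have "i \<le> ?s k" by (cases k) auto
    then show ?thesis by (intro sum.cong) auto
  next
    case False
    then show ?thesis by (simp only: if_False if_cancel)
  qed
  also have "\<dots> = (if (\<forall>j\<in>{1..Suc k}. i < ?s j) \<and> c + i = ?s (Suc k) then 1 else 0)"
    using \<open>?s k < q ^ m\<close> r by (auto simp: N_def)
  finally show ?case .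
qed

lemma shift_mat_nilpotent:
  assumes q: "0 < q" and m: "0 < m"
  shows "shift_mat q m i ^\<^sub>m m = 0\<^sub>m (q ^ m - i) (q ^ m - i)"
proof (rule eq_matI)
  let ?N = "q ^ m - i"
  fix r c assume "r < dim_row (0\<^sub>m ?N ?N :: int mat)" "c < dim_col (0\<^sub>m ?N ?N :: int mat)"
  then have rc: "r < ?N" "c < ?N" by auto
  have "(digit_shift q m ^^ m) (r + i) = 0"
    using rc by (subst digit_shift_funpow) auto
  then have "\<not> (\<forall>j\<in>{1..m}. i < (digit_shift q m ^^ j) (r + i))"
    using m by (metis atLeastAtMost_iff less_eq_Suc_le not_less_zero One_nat_def order_refl)
  then show "(shift_mat q m i ^\<^sub>m m) $$ (r, c) = 0\<^sub>m ?N ?N $$ (r, c)"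
    using rc shift_mat_power[OF q m rc, of m] by auto
qed (auto simp: shift_mat_def)

text \<open>The digit at position \<open>k\<close> is read off the orbit after \<open>k - 1\<close> shifts, since positions are
  counted from 1.\<close>

definition orbit_digits :: "nat \<Rightarrow> nat \<Rightarrow> nat \<Rightarrow> nat \<Rightarrow> nat" where
  "orbit_digits q m i k =
     (if k \<le> prefix_len q m i then weight q m i ((digit_shift q m ^^ (k - 1)) i) else 0)"

lemma prefix_len_orbit:
  assumes q: "0 < q" and m: "0 < m" and i: "i < q ^ m"
  shows "prefix_len q m i \<in> {1..m}"
    and "(digit_shift q m ^^ prefix_len q m i) i \<le> i"
    and "\<And>j. 1 \<le> j \<Longrightarrow> j < prefix_len q m i \<Longrightarrow> i < (digit_shift q m ^^ j) i"
proof -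
  let ?J = "{j. 1 \<le> j \<and> j \<le> m \<and> part q i j \<ge> residue q i (m - j)}"
  have J: "finite ?J" "m \<in> ?J" using prefix_len_set[of m i q] m i by auto
  then have l: "prefix_len q m i \<in> ?J"
    unfolding prefix_len_def by (intro Min_in) auto
  then show "prefix_len q m i \<in> {1..m}" by simp
  show "(digit_shift q m ^^ prefix_len q m i) i \<le> i"
    using l by (subst digit_shift_funpow_le_iff) (use i q in auto)
  fix j assume j: "1 \<le> j" "j < prefix_len q m i"
  have "j \<notin> ?J" using j(2) Min_le[OF J(1), of j] unfolding prefix_len_def by (meson not_less)
  then have "\<not> (digit_shift q m ^^ j) i \<le> i"
    using j l by (subst digit_shift_funpow_le_iff) (use i q in auto)
  then show "i < (digit_shift q m ^^ j) i" by simp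
qed

text \<open>Before the first return, row \<open>i\<close> of \<open>F ^ k\<close> is the unit vector at the \<open>k\<close>-th point of the
  orbit; from the first return on it is zero. Both sides carry a monomial factor because
  \<open>q ^ m - i - m\<close> may be negative.\<close>

lemma monom_mult_char_poly_A_mat_trunc:
  assumes q: "0 < q" and m: "0 < m" and i: "i < q ^ m"
  shows "monom 1 m * char_poly (A_mat_trunc q m i)
    = monom 1 (q ^ m - i) * g_poly m (orbit_digits q m i)"
proof -
  let ?N = "q ^ m - i" and ?s = "\<lambda>k. (digit_shift q m ^^ k) i"
  let ?F = "shift_mat q m i"
  have F: "?F \<in> carrier_mat ?N ?N" by (simp add: shift_mat_def)
  note l = prefix_len_orbit[OF q m i]
  have coeff: "(\<Sum>j<?N. (?F ^\<^sub>m k) $$ (0, j) * int (weight q m i (j + i)))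
      = int (orbit_digits q m i (Suc k))" if "k < m" for k
  proof -
    have stays: "(\<forall>j\<in>{1..k}. i < ?s j) \<longleftrightarrow> Suc k \<le> prefix_len q m i"
    proof
      assume "\<forall>j\<in>{1..k}. i < ?s j"
      then show "Suc k \<le> prefix_len q m i"
        using l(1,2) by (metis atLeastAtMost_iff not_less not_less_eq_eq)
    qed (use l(3) in auto)
    have "?s k < q ^ m" using digit_shift_less[OF q m] i by (cases k) auto
    have "(\<Sum>j<?N. (?F ^\<^sub>m k) $$ (0, j) * int (weight q m i (j + i)))
        = (\<Sum>j<?N. if j + i = ?s k
            then int (if Suc k \<le> prefix_len q m i then weight q m i (?s k) else 0) else 0)"
      using shift_mat_power[OF q m, of 0 i _ k] i
      by (intro sum.cong refl) (simp add: stays del: One_nat_def)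
    also have "\<dots> = (\<Sum>j<?N. if j = ?s k - i
            then int (if Suc k \<le> prefix_len q m i then weight q m i (?s k) else 0) else 0)"
    proof (cases "Suc k \<le> prefix_len q m i")
      case True
      then have "i \<le> ?s k" using l(3)[of k] by (cases k) auto
      then show ?thesis by (intro sum.cong) auto
    next
      case False
      then show ?thesis by (simp only: if_False of_nat_0 if_cancel)
    qed
    also have "\<dots> = int (orbit_digits q m i (Suc k))"
      using \<open>?s k < q ^ m\<close> i by (auto simp: orbit_digits_def)
    finally show ?thesis .
  qed
  have "monom 1 m * char_poly (A_mat_trunc q m i) = monom 1 ?N * (monom 1 m
      - (\<Sum>k<m. monom (\<Sum>j<?N. (?F ^\<^sub>m k) $$ (0, j) * int (weight q m i (j + i))) (m - 1 - k)))"
    unfolding char_poly_A_mat_trunc_threshold[OF q m i]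
    by (rule char_poly_nilpotent_column_update[OF F shift_mat_nilpotent[OF q m]])
      (use i in \<open>auto simp: threshold_action_def\<close>)
  also have "\<dots> = monom 1 ?N * (monom 1 m - (\<Sum>k<m. monom (int (orbit_digits q m i (Suc k))) (m - Suc k)))"
    using coeff by simp
  also have "\<dots> = monom 1 ?N * g_poly m (orbit_digits q m i)"
    by (simp add: g_poly_def sum.atLeast1_atMost_eq)
  finally show ?thesis .
qed

section \<open>The base expansion\<close>

text \<open>The first \<open>k\<close> digits of \<open>i\<close> are the leading digits of the first \<open>k\<close> orbit points, starting with \<open>i\<close> itself. Adding them
  to their complements gives \<open>q - 1\<close> in each of these places, that is \<open>q ^ m - q ^ (m - k)\<close>.\<close>

lemma complement_digits_sum:
  assumes q: "0 < q" and i: "i < q ^ m" and k: "k \<le> m"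
  shows "(\<Sum>j=1..k. (q - 1 - (digit_shift q m ^^ (j - 1)) i div q ^ (m - 1)) * q ^ (m - j))
    + q ^ (m - k) + i = q ^ m + i mod q ^ (m - k)"
  using k
proof (induction k)
  case 0
  then show ?case using i by simp
next
  case (Suc k)
  define X where "X = q ^ (m - Suc k)"
  define d where "d = i mod q ^ (m - k) div X"
  have X: "0 < X" using q by (simp add: X_def)
  have qX: "q ^ (m - k) = q * X"
    using Suc.prems unfolding X_def by (metis Suc_diff_le Suc_le_lessD diff_Suc_Suc power_Suc)
  have d: "d < q" unfolding d_def qX using X q by (simp add: div_less_iff_less_mult)
  have "(digit_shift q m ^^ k) i div q ^ (m - 1) = q ^ k * (i mod q ^ (m - k)) div (q ^ k * X)"
    using Suc.prems i by (simp add: digit_shift_funpow X_def flip: power_add)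
  also have "\<dots> = d" using q by (simp add: d_def)
  finally have digit: "(digit_shift q m ^^ k) i div q ^ (m - 1) = d" .
  have "i mod q ^ (m - k) mod X = i mod X"
    unfolding qX by (rule mod_mod_cancel) simp
  then have split: "i mod q ^ (m - k) = d * X + i mod X"
    unfolding d_def by (metis div_mult_mod_eq)
  have "(q - 1 - d) * X + X + d * X = (q - 1 - d + 1 + d) * X"
    by (simp only: add_mult_distrib mult_1)
  also have "q - 1 - d + 1 + d = q" using d by simp
  finally have "(q - 1 - d) * X + X + d * X = q * X" .
  with Suc split digit qX show ?case by (simp flip: X_def)
qed

text \<open>The carry \<open>q ^ (m - l)\<close> that turns complemented digits into a subtraction from \<open>q ^ m\<close> is
  supplied by the extra 1 in the weight at the first return. That this never produces the digit \<open>q\<close>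
  is where \<open>i > 0\<close> enters: it would need an orbit point \<open>t \<ge> i\<close> with leading digit 0, but the shift
  multiplies such a \<open>t\<close> by \<open>q\<close> and so cannot take it to \<open>i\<close> or below.\<close>

lemma orbit_digits_base_expansion:
  assumes q2: "2 \<le> q" and m: "0 < m" and i: "0 < i" "i < q ^ m"
  shows "is_base_expansion q m (q ^ m - min_prefix q m i) (orbit_digits q m i)"
proof -
  have q: "0 < q" using q2 by simp
  let ?s = "\<lambda>k. (digit_shift q m ^^ k) i" and ?l = "prefix_len q m i"
  note l = prefix_len_orbit[OF q m i(2)]
  have less: "orbit_digits q m i k < q" if k: "k \<in> {1..m}" for k
  proof (cases "k \<le> ?l")
    case True
    define t where "t = ?s (k - 1)"
    have t: "i \<le> t"
    proof (cases "k = 1")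
      case False
      then have "1 \<le> k - 1" and "k - 1 < ?l" using True k by auto
      then show ?thesis using l(3) unfolding t_def by (intro less_imp_le)
    qed (simp add: t_def)
    have "\<not> (t div q ^ (m - 1) = 0 \<and> digit_shift q m t \<le> i)"
    proof
      assume h: "t div q ^ (m - 1) = 0 \<and> digit_shift q m t \<le> i"
      then have "t < q ^ (m - 1)" using q by (simp add: div_eq_0_iff)
      then have "q * t \<le> i" using h by (simp add: digit_shift_def)
      moreover have "2 * t \<le> q * t" using q2 by simp
      ultimately show False using t i by linarith
    qed
    then have "weight q m i t < q" using q2 by (auto simp: weight_def)
    then show ?thesis using True by (simp add: orbit_digits_def t_def)
  qed (use q in \<open>simp add: orbit_digits_def\<close>)
  have "(\<Sum>k=1..m. orbit_digits q m i k * q ^ (m - k)) = (\<Sum>k=1..?l. orbit_digits q m i k * q ^ (m - k))"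
    by (rule sum.mono_neutral_right) (use l(1) in \<open>auto simp: orbit_digits_def\<close>)
  also have "\<dots> = (\<Sum>k=1..?l. (q - 1 - ?s (k - 1) div q ^ (m - 1)) * q ^ (m - k)
      + (if k = ?l then q ^ (m - ?l) else 0))"
  proof (intro sum.cong refl)
    fix k assume k: "k \<in> {1..?l}"
    then have "digit_shift q m (?s (k - 1)) = ?s k" by (cases k) auto
    moreover have "?s k \<le> i \<longleftrightarrow> k = ?l" using l(2) l(3)[of k] k by fastforce
    ultimately show "orbit_digits q m i k * q ^ (m - k)
        = (q - 1 - ?s (k - 1) div q ^ (m - 1)) * q ^ (m - k) + (if k = ?l then q ^ (m - ?l) else 0)"
      using k by (simp add: orbit_digits_def weight_def add_mult_distrib)
  qed
  also have "\<dots> = (\<Sum>k=1..?l. (q - 1 - ?s (k - 1) div q ^ (m - 1)) * q ^ (m - k)) + q ^ (m - ?l)"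
    using l(1) by (simp add: sum.distrib)
  finally have "(\<Sum>k=1..m. orbit_digits q m i k * q ^ (m - k)) + i = q ^ m + i mod q ^ (m - ?l)"
    using complement_digits_sum[OF q i(2), of ?l] l(1) by simp
  moreover have "i mod q ^ (m - ?l) \<le> i" by simp
  ultimately have "q ^ m - min_prefix q m i = (\<Sum>k=1..m. orbit_digits q m i k * q ^ (m - k))"
    using i unfolding min_prefix_def residue_def by linarith
  with less show ?thesis by (simp add: is_base_expansion_def)
qed

lemma is_base_expansion_unique:
  assumes "is_base_expansion q m N a" "is_base_expansion q m N b" "k \<in> {1..m}"
  shows "a k = b k"
  using assms
proof (induction m arbitrary: N k)
  case (Suc m)
  have step: "N mod q = c (Suc m) \<and> is_base_expansion q m (N div q) c"
    if c: "is_base_expansion q (Suc m) N c" for c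
  proof -
    have "(\<Sum>k=1..m. c k * q ^ (Suc m - k)) = q * (\<Sum>k=1..m. c k * q ^ (m - k))"
      by (auto simp: sum_distrib_left Suc_diff_le intro!: sum.cong)
    then have N: "N = q * (\<Sum>k=1..m. c k * q ^ (m - k)) + c (Suc m)" and "c (Suc m) < q"
      using c by (auto simp: is_base_expansion_def)
    then have "N mod q = c (Suc m)" and "N div q = (\<Sum>k=1..m. c k * q ^ (m - k))"
      unfolding N by (simp_all del: One_nat_def)
    then show ?thesis using c by (auto simp: is_base_expansion_def)
  qed
  show ?case
    using Suc.IH[of "N div q" k] step[OF Suc.prems(1)] step[OF Suc.prems(2)] Suc.prems(3)
    by (cases "k = Suc m") auto
qed simp

theorem theorem5:
  fixes q m i :: nat
  assumes "q \<ge> 2" and "m \<ge> 1" and "0 < i" and "i < q ^ m"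
  shows "(\<exists>a. is_base_expansion q m (q ^ m - min_prefix q m i) a) \<and>
    (\<forall>a. is_base_expansion q m (q ^ m - min_prefix q m i) a \<longrightarrow>
       fls_of_int_poly (char_poly (A_mat_trunc q m i)) =
         fls_of_int_poly (g_poly m a) * fls_X_intpow (int (q ^ m) - int m - int i))"
proof (intro conjI allI impI)
  have q: "0 < q" and m: "0 < m" using assms by auto
  note expansion = orbit_digits_base_expansion[OF assms(1) m assms(3,4)]
  then show "\<exists>a. is_base_expansion q m (q ^ m - min_prefix q m i) a" by blast
  fix a assume "is_base_expansion q m (q ^ m - min_prefix q m i) a"
  then have "g_poly m a = g_poly m (orbit_digits q m i)"
    using is_base_expansion_unique[OF _ expansion] by (auto simp: g_poly_def)
  then have eq: "monom 1 m * char_poly (A_mat_trunc q m i) = monom 1 (q ^ m - i) * g_poly m a"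
    using monom_mult_char_poly_A_mat_trunc[OF q m assms(4)] by simp
  have monom: "fls_of_int_poly (monom 1 n * p) = fls_of_int_poly p * fls_X_intpow (int n)" for n p
    by (simp add: fls_of_int_poly_def fps_of_poly_mult fps_of_poly_monom fls_times_fps_to_fls
        fps_to_fls_power fls_X_power_conv_shift_1 mult.commute)
  have "fls_of_int_poly (char_poly (A_mat_trunc q m i))
      = fls_of_int_poly (char_poly (A_mat_trunc q m i)) * (fls_X_intpow (int m) * fls_X_intpow (- int m))"
    by (subst fls_X_intpow_times_fls_X_intpow) simp
  also have "\<dots> = fls_of_int_poly (g_poly m a)
      * (fls_X_intpow (int (q ^ m - i)) * fls_X_intpow (- int m))"
    using arg_cong[OF eq, of fls_of_int_poly] by (simp only: monom mult.assoc[symmetric])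
  also have "fls_X_intpow (int (q ^ m - i)) * fls_X_intpow (- int m)
      = (fls_X_intpow (int (q ^ m) - int m - int i) :: int fls)"
    using assms by (subst fls_X_intpow_times_fls_X_intpow) (simp add: of_nat_diff algebra_simps)
  finally show "fls_of_int_poly (char_poly (A_mat_trunc q m i)) =
      fls_of_int_poly (g_poly m a) * fls_X_intpow (int (q ^ m) - int m - int i)" .
qed

end
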